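(* For a finite set $X$, let $\overline{\omega}_X$ be the maximum partitioned binary relation on $(X,X)$ with respect to inclusion (i.e. the full relation on $X\coprod X$), and let $\overline{A}_X$ be the set of all pairs $(\alpha,\alpha')\in\mathfrak{PB}(X,X)\times\mathfrak{PB}(X,X)$ such that $\alpha\circ\alpha'=\overline{\omega}_X$. Then $$\lim_{|X|\to\infty}\frac{|\overline{A}_X|}{|\mathfrak{PB}(X,X)\times\mathfrak{PB}(X,X)|}=1.$$
   Context: For finite sets $X,Y$, a partitioned binary relation (PBR) on $(X,Y)$ is a binary relation $\alpha\subseteq (X\coprod Y)^2$ on the disjoint union $X\coprod Y$ ($X$ the domain, $Y$ the codomain; pairs $(a,b)\in\alpha$ are called edges). $\mathfrak{PB}(X,Y)$ is the set of all PBRs on $(X,Y)$. Composition: let $\alpha$ be a PBR on $(X,Y)$ and $\beta$ a PBR on $(Y,Z)$; regard edges of both as pairs of elements of $X\coprod Y\coprod Z$ (with distinct copies of the sets, even if the sets coincide). An $(\alpha,\beta)$-connected sequence is a finite nonempty sequence $(a_1,b_1),\dots,(a_m,b_m)$ of edges, each taken from $\alpha$ or from $\beta$ (one keeps track of which), such that no two successive edges are taken from the same PBR and $b_i=a_{i+1}$ for $i=1,\dots,m-1$; it connects $a_1$ to $b_m$. $\beta\circ\alpha$ is the PBR on $(X,Z)$ such that, for $a,b\in X\coprod Z$, $(a,b)\in\beta\circ\alpha$ iff some $(\alpha,\beta)$-connected sequence connects $a$ to $b$. *)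

theory Defs
  imports Complex_Main
begin

definition PB :: "'a set \<Rightarrow> 'b set \<Rightarrow> ('a + 'b) rel set" where
  "PB X Y = Pow ((X <+> Y) \<times> (X <+> Y))"

definition full_pbr :: "'a set \<Rightarrow> ('a + 'a) rel" where
  "full_pbr X = (X <+> X) \<times> (X <+> X)"

lemma full_pbr_in_PB: "full_pbr X \<in> PB X X"
  by (simp add: full_pbr_def PB_def)

lemma full_pbr_maximum: "\<alpha> \<in> PB X X \<Longrightarrow> \<alpha> \<subseteq> full_pbr X"
  by (simp add: full_pbr_def PB_def)

text \<open>
  The disjoint union of three sets X, Y, Z is taken in \<^typ>\<open>'a + 'b + 'c\<close>, that is
  \<^typ>\<open>'a + ('b + 'c)\<close>. The inclusions of the vertices of a PBR on (X, Y), of a PBR on (Y, Z)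
  and of the composite on (X, Z) are \<^term>\<open>map_sum id Inl\<close>, \<^term>\<open>Inr\<close> and
  \<^term>\<open>map_sum id Inr\<close>. Every edge carries a tag recording the PBR from which it is taken;
  this matters for edges between two vertices of Y, which may belong to both.
\<close>

datatype origin = First | Second

type_synonym ('a, 'b, 'c) tagged_edge = "origin \<times> ('a + 'b + 'c) \<times> ('a + 'b + 'c)"

definition tagged_edges ::
    "('a + 'b) rel \<Rightarrow> ('b + 'c) rel \<Rightarrow> ('a, 'b, 'c) tagged_edge set" where
  "tagged_edges \<alpha> \<beta> =
     {(First, map_sum id Inl a, map_sum id Inl b) | a b. (a, b) \<in> \<alpha>} \<union>
     {(Second, Inr a, Inr b) | a b. (a, b) \<in> \<beta>}"

definition connected_seq ::
    "('a + 'b) rel \<Rightarrow> ('b + 'c) rel \<Rightarrow> ('a, 'b, 'c) tagged_edge list \<Rightarrow> bool" where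
  "connected_seq \<alpha> \<beta> es \<longleftrightarrow>
     es \<noteq> [] \<and> set es \<subseteq> tagged_edges \<alpha> \<beta> \<and>
     successively (\<lambda>(s, a, b) (s', a', b'). s \<noteq> s' \<and> b = a') es"

definition connects ::
    "('a, 'b, 'c) tagged_edge list \<Rightarrow> 'a + 'b + 'c \<Rightarrow> 'a + 'b + 'c \<Rightarrow> bool" where
  "connects es a b \<longleftrightarrow> fst (snd (hd es)) = a \<and> snd (snd (last es)) = b"

text \<open>
  The carrier sets are not arguments of the composition: for a PBR on (X, Y) and one on (Y, Z),
  the end points of a connected sequence lie in the carriers anyway (lemma \<open>pbr_comp_in_PB\<close>).
\<close>

definition pbr_comp ::
    "('b + 'c) rel \<Rightarrow> ('a + 'b) rel \<Rightarrow> ('a + 'c) rel"  (infixl "\<circ>\<^sub>P" 55) where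
  "\<beta> \<circ>\<^sub>P \<alpha> =
     {(a, b). \<exists>es. connected_seq \<alpha> \<beta> es \<and> connects es (map_sum id Inr a) (map_sum id Inr b)}"

lemma tagged_edge_vertices:
  fixes e :: "('a, 'b, 'c) tagged_edge"
  assumes "\<alpha> \<in> PB X Y" "\<beta> \<in> PB Y Z" "e \<in> tagged_edges \<alpha> \<beta>"
  shows "fst (snd e) \<in> X <+> (Y <+> Z)" "snd (snd e) \<in> X <+> (Y <+> Z)"
  using assms by (fastforce simp: PB_def tagged_edges_def)+

lemma outer_vertex:
  "(map_sum id Inr a :: 'a + 'b + 'c) \<in> X <+> (Y <+> Z) \<longleftrightarrow> a \<in> X <+> Z"
  by (cases a) auto

lemma pbr_comp_in_PB:
  assumes "\<alpha> \<in> PB X Y" "\<beta> \<in> PB Y Z"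
  shows "\<beta> \<circ>\<^sub>P \<alpha> \<in> PB X Z"
proof -
  have "a \<in> X <+> Z \<and> b \<in> X <+> Z" if "(a, b) \<in> \<beta> \<circ>\<^sub>P \<alpha>" for a b
  proof -
    from that obtain es where es: "connected_seq \<alpha> \<beta> es"
      "connects es (map_sum id Inr a) (map_sum id Inr b)"
      by (auto simp: pbr_comp_def)
    then have "hd es \<in> tagged_edges \<alpha> \<beta>" "last es \<in> tagged_edges \<alpha> \<beta>"
      by (auto simp: connected_seq_def)
    then show ?thesis
      using es(2) tagged_edge_vertices[OF assms] outer_vertex
      unfolding connects_def by metis
  qed
  then show ?thesis by (auto simp: PB_def)
qed

definition full_pairs :: "'a set \<Rightarrow> (('a + 'a) rel \<times> ('a + 'a) rel) set" where
  "full_pairs X = {(\<alpha>, \<alpha>') \<in> PB X X \<times> PB X X. \<alpha> \<circ>\<^sub>P \<alpha>' = full_pbr X}"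

text \<open>The filter of finite subsets of a type whose cardinality tends to infinity.\<close>

definition card_to_infinity :: "'a set filter" where
  "card_to_infinity = inf (filtercomap card at_top) (principal {X. finite X})"

lemma eventually_card_to_infinity:
  "eventually P card_to_infinity \<longleftrightarrow> (\<exists>N. \<forall>X. finite X \<and> N \<le> card X \<longrightarrow> P X)"
  by (auto simp: card_to_infinity_def eventually_inf_principal eventually_filtercomap
      eventually_at_top_linorder)

lemma card_to_infinity_neq_bot:
  assumes "infinite (UNIV :: 'a set)"
  shows "(card_to_infinity :: 'a set filter) \<noteq> bot"
  unfolding trivial_limit_def eventually_card_to_infinity
  using infinite_arbitrarily_large[OF assms] by (metis order_refl)

end

theory Submission
  imports Defs "HOL-Library.Disjoint_Sets" "HOL-Real_Asymp.Real_Asymp"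
begin

text \<open>
  Choose \<open>\<alpha>\<close> and \<open>\<alpha>'\<close> uniformly at random, so that each of the possible edges of either relation is
  present independently with probability \<open>1/2\<close>. For given vertices \<open>a\<close> and \<open>b\<close> of the composite
  \<open>\<alpha> \<circ>\<^sub>P \<alpha>'\<close>, every middle vertex \<open>y\<close> offers a connected sequence from \<open>a\<close> to \<open>b\<close> through \<open>y\<close>. If \<open>a\<close> and
  \<open>b\<close> lie on different sides, the sequence is \<open>a, y, b\<close>, with one edge from each relation. If they
  lie on the same side, both outer edges come from the same relation, and the alternation is
  restored by a loop at \<open>y\<close> from the other relation: \<open>a, y, y, b\<close>. In either case the sequence needs
  at most three edges, and the sequences for different \<open>y\<close> share no edge. By independence, the
  probability that all of them fail is at most \<open>(7/8)^n\<close> for \<open>n = card X\<close> (lemma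
  \<open>card_subsets_avoiding_disjoint_family\<close>, in terms of cardinalities). There are \<open>4 n\<^sup>2\<close> pairs
  \<open>(a, b)\<close>, so the composite fails to be the full relation with probability at most
  \<open>4 n\<^sup>2 (7/8)^n\<close>, which tends to \<open>0\<close>.
\<close>

text \<open>
  Independence in counting form: a random subset of \<open>U\<close> contains \<open>T i\<close> with probability at least
  \<open>1/2^k\<close>, and for disjoint sets \<open>T i\<close> these events are independent. The induction splits off one
  \<open>T i\<close> by sending \<open>S\<close> to \<open>(S \<inter> T i, S - T i)\<close>; the first component misses the value \<open>T i\<close>.
\<close>

lemma card_subsets_avoiding_disjoint_family:
  fixes T :: "'i \<Rightarrow> 'e set"
  assumes "finite I" "finite U"
    and "\<And>i. i \<in> I \<Longrightarrow> T i \<subseteq> U" "\<And>i. i \<in> I \<Longrightarrow> card (T i) \<le> k"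
    and "disjoint_family_on T I"
  shows "real (card {S. S \<subseteq> U \<and> (\<forall>i\<in>I. \<not> T i \<subseteq> S)}) \<le> (1 - 1 / 2 ^ k) ^ card I * 2 ^ card U"
  using assms
proof (induction I arbitrary: U rule: finite_induct)
  case empty
  then show ?case
    using card_Pow[of U] by (simp add: Pow_def)
next
  case (insert j I)
  let ?T = "T j" and ?p = "1 - 1 / 2 ^ k :: real"
  let ?A = "{S. S \<subseteq> U \<and> (\<forall>i\<in>insert j I. \<not> T i \<subseteq> S)}"
  let ?B = "{S. S \<subseteq> U - ?T \<and> (\<forall>i\<in>I. \<not> T i \<subseteq> S)}"
  have TU: "?T \<subseteq> U" and card_T: "card ?T \<le> k"
    using insert.prems by auto
  have disj: "T i \<inter> ?T = {}" if "i \<in> I" for i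
    using insert.prems(4) insert.hyps(2) that by (auto simp: disjoint_family_on_def)
  have fin_T: "finite ?T"
    using TU insert.prems(1) finite_subset by blast
  have "disjoint_family_on T I"
    using insert.prems(4) by (auto simp: disjoint_family_on_def)
  moreover have "T i \<subseteq> U - ?T" if "i \<in> I" for i
    using insert.prems(2) disj that by blast
  ultimately have IH: "real (card ?B) \<le> ?p ^ card I * 2 ^ card (U - ?T)"
    using insert.prems by (intro insert.IH) auto
  have fin_B: "finite ?B"
    using insert.prems(1) by simp
  have "inj_on (\<lambda>S. (S \<inter> ?T, S - ?T)) ?A"
    by (rule inj_onI) blast
  moreover have "(\<lambda>S. (S \<inter> ?T, S - ?T)) ` ?A \<subseteq> (Pow ?T - {?T}) \<times> ?B"
    using disj by fastforce
  ultimately have "card ?A \<le> card ((Pow ?T - {?T}) \<times> ?B)"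
    using fin_T fin_B by (intro card_inj_on_le) auto
  then have "real (card ?A) \<le> real (card (Pow ?T - {?T})) * real (card ?B)"
    by (simp add: card_cartesian_product flip: of_nat_mult)
  also have "real (card (Pow ?T - {?T})) = 2 ^ card ?T - 1"
    using fin_T by (simp add: card_Diff_subset card_Pow of_nat_diff)
  also have "(2 ^ card ?T - 1) * real (card ?B)
      \<le> (?p * 2 ^ card ?T) * (?p ^ card I * 2 ^ card (U - ?T))"
  proof (intro mult_mono IH)
    have "(2 :: real) ^ card ?T \<le> 2 ^ k"
      using card_T by (simp add: power_increasing)
    then show "2 ^ card ?T - 1 \<le> ?p * 2 ^ card ?T"
      by (simp add: field_simps)
  qed auto
  also have "\<dots> = ?p ^ card (insert j I) * (2 ^ card ?T * 2 ^ card (U - ?T))"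
    using insert.hyps by simp
  also have "2 ^ card ?T * 2 ^ card (U - ?T) = (2 ^ card U :: real)"
    using TU fin_T insert.prems(1) card_mono[OF insert.prems(1) TU]
    by (simp add: card_Diff_subset flip: power_add)
  finally show ?case .
qed

text \<open>
  The edges of the sequence from \<open>a\<close> to \<open>b\<close> through the middle vertex \<open>y\<close>. An edge of the first
  relation is tagged by \<^const>\<open>Inl\<close> and an edge of the second one by \<^const>\<open>Inr\<close>, so that a pair of
  relations becomes the single set \<open>\<alpha>' <+> \<alpha>\<close>. The middle vertex is \<open>Inr y\<close> as a vertex of the first
  relation and \<open>Inl y\<close> as a vertex of the second.
\<close>

fun link :: "'a + 'c \<Rightarrow> 'a + 'c \<Rightarrow> 'b \<Rightarrow>
    ((('a + 'b) \<times> ('a + 'b)) + (('b + 'c) \<times> ('b + 'c))) set" where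
  "link (Inl x) (Inl x') y = {Inl (Inl x, Inr y), Inr (Inl y, Inl y), Inl (Inr y, Inl x')}"
| "link (Inl x) (Inr z) y = {Inl (Inl x, Inr y), Inr (Inl y, Inr z)}"
| "link (Inr z) (Inl x) y = {Inr (Inr z, Inl y), Inl (Inr y, Inl x)}"
| "link (Inr z) (Inr z') y = {Inr (Inr z, Inl y), Inl (Inr y, Inr y), Inr (Inl y, Inr z')}"

lemma link_imp_in_pbr_comp:
  fixes \<alpha> :: "('a + 'b) rel" and \<beta> :: "('b + 'c) rel"
  assumes "link a b y \<subseteq> \<alpha> <+> \<beta>"
  shows "(a, b) \<in> \<beta> \<circ>\<^sub>P \<alpha>"
proof -
  have "\<exists>es. connected_seq \<alpha> \<beta> es \<and> connects es (map_sum id Inr a) (map_sum id Inr b)"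
  proof (cases a; cases b)
    fix x x' assume ab: "a = Inl x" "b = Inl x'"
    show ?thesis
      using assms unfolding ab
      by (intro exI[of _ "[(First, Inl x, Inr (Inl y)), (Second, Inr (Inl y), Inr (Inl y)),
            (First, Inr (Inl y), Inl x')]"])
        (force simp: connected_seq_def connects_def tagged_edges_def)
  next
    fix x z assume ab: "a = Inl x" "b = Inr z"
    show ?thesis
      using assms unfolding ab
      by (intro exI[of _ "[(First, Inl x, Inr (Inl y)), (Second, Inr (Inl y), Inr (Inr z))]"])
        (force simp: connected_seq_def connects_def tagged_edges_def)
  next
    fix z x assume ab: "a = Inr z" "b = Inl x"
    show ?thesis
      using assms unfolding ab
      by (intro exI[of _ "[(Second, Inr (Inr z), Inr (Inl y)), (First, Inr (Inl y), Inl x)]"])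
        (force simp: connected_seq_def connects_def tagged_edges_def)
  next
    fix z z' assume ab: "a = Inr z" "b = Inr z'"
    show ?thesis
      using assms unfolding ab
      by (intro exI[of _ "[(Second, Inr (Inr z), Inr (Inl y)), (First, Inr (Inl y), Inr (Inl y)),
            (Second, Inr (Inl y), Inr (Inr z'))]"])
        (force simp: connected_seq_def connects_def tagged_edges_def)
  qed
  then show ?thesis by (simp add: pbr_comp_def)
qed

lemma link_subset:
  assumes "a \<in> X <+> Z" "b \<in> X <+> Z" "y \<in> Y"
  shows "link a b y \<subseteq> (X <+> Y) \<times> (X <+> Y) <+> (Y <+> Z) \<times> (Y <+> Z)"
  using assms by (cases a; cases b) auto

lemma card_link_le: "card (link a b y) \<le> 3"
  by (cases a; cases b) (auto intro!: card_insert_le_m1)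

lemma disjoint_links: "disjoint_family_on (link a b) Y"
  unfolding disjoint_family_on_def by (cases a; cases b) auto

text \<open>
  The failure probability at one pair \<open>(a, b)\<close>: at most three edges per link give the factor
  \<open>1 - 1/2^3 = 7/8\<close> for each middle vertex.
\<close>

lemma card_pairs_missing_edge_le:
  fixes X :: "'a set"
  assumes "finite X" "a \<in> X <+> X" "b \<in> X <+> X"
  shows "real (card {(\<alpha>, \<alpha>'). (\<alpha>, \<alpha>') \<in> PB X X \<times> PB X X \<and> (a, b) \<notin> \<alpha> \<circ>\<^sub>P \<alpha>'})
    \<le> (7 / 8) ^ card X * real (card (PB X X \<times> PB X X))"
proof -
  let ?E = "(X <+> X) \<times> (X <+> X)"
  let ?bad = "{(\<alpha>, \<alpha>'). (\<alpha>, \<alpha>') \<in> PB X X \<times> PB X X \<and> (a, b) \<notin> \<alpha> \<circ>\<^sub>P \<alpha>'}"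
  let ?avoid = "{S. S \<subseteq> ?E <+> ?E \<and> (\<forall>y\<in>X. \<not> link a b y \<subseteq> S)}"
  have fin: "finite ?E"
    using assms(1) by simp
  have "inj_on (\<lambda>(\<alpha>, \<alpha>'). \<alpha>' <+> \<alpha>) ?bad"
    by (rule inj_onI) (auto simp: Plus_def)
  moreover have "(\<lambda>(\<alpha>, \<alpha>'). \<alpha>' <+> \<alpha>) ` ?bad \<subseteq> ?avoid"
    by (auto simp: PB_def dest: link_imp_in_pbr_comp)
  ultimately have "card ?bad \<le> card ?avoid"
    using fin by (intro card_inj_on_le) auto
  also have "real (card ?avoid) \<le> (1 - 1 / 2 ^ 3) ^ card X * 2 ^ card (?E <+> ?E)"
  proof (rule card_subsets_avoiding_disjoint_family[OF assms(1)])
    show "finite (?E <+> ?E)"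
      using fin by simp
    show "link a b y \<subseteq> ?E <+> ?E" if "y \<in> X" for y
      using assms(2,3) that by (rule link_subset)
  qed (rule card_link_le disjoint_links)+
  also have "\<dots> = (7 / 8) ^ card X * real (card (PB X X \<times> PB X X))"
    using fin by (simp add: PB_def card_cartesian_product card_Pow card_Plus power_add)
  finally show ?thesis by simp
qed

text \<open>The union bound over the \<open>(2 n)\<^sup>2\<close> pairs of vertices of the composite.\<close>

lemma card_full_pairs_ge:
  fixes X :: "'a set"
  assumes "finite X"
  shows "(1 - 4 * real (card X) ^ 2 * (7 / 8) ^ card X) * real (card (PB X X \<times> PB X X))
    \<le> real (card (full_pairs X))"
proof -
  let ?P = "PB X X \<times> PB X X"
  let ?bad = "\<lambda>(a, b). {(\<alpha>, \<alpha>'). (\<alpha>, \<alpha>') \<in> ?P \<and> (a, b) \<notin> \<alpha> \<circ>\<^sub>P \<alpha>'}"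
  have fin_P: "finite ?P"
    using assms by (simp add: PB_def)
  have fin_bad: "finite (\<Union>e\<in>full_pbr X. ?bad e)"
    by (rule finite_subset[OF _ fin_P]) auto
  have "?P \<subseteq> full_pairs X \<union> (\<Union>e\<in>full_pbr X. ?bad e)"
    using full_pbr_maximum[OF pbr_comp_in_PB] by (fastforce simp: full_pairs_def)
  moreover have fin_full: "finite (full_pairs X)"
    by (rule finite_subset[OF _ fin_P]) (auto simp: full_pairs_def)
  ultimately have "card ?P \<le> card (full_pairs X) + card (\<Union>e\<in>full_pbr X. ?bad e)"
    using fin_bad by (meson card_Un_le card_mono finite_UnI le_trans)
  then have "real (card ?P) \<le> real (card (full_pairs X)) + real (card (\<Union>e\<in>full_pbr X. ?bad e))"
    by linarith
  also have "card (\<Union>e\<in>full_pbr X. ?bad e) \<le> (\<Sum>e\<in>full_pbr X. card (?bad e))"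
    using assms by (intro card_UN_le) (simp add: full_pbr_def)
  also have "real (\<Sum>e\<in>full_pbr X. card (?bad e))
      \<le> (\<Sum>e\<in>full_pbr X. (7 / 8) ^ card X * real (card ?P))"
    unfolding of_nat_sum
    using card_pairs_missing_edge_le[OF assms]
    by (intro sum_mono) (auto simp only: full_pbr_def split: prod.splits)
  also have "\<dots> = 4 * real (card X) ^ 2 * (7 / 8) ^ card X * real (card ?P)"
    using assms
    by (simp add: full_pbr_def card_cartesian_product card_Plus power2_eq_square algebra_simps)
  finally show ?thesis by (simp add: algebra_simps)
qed

theorem theorem21:
  "((\<lambda>X :: 'a set. real (card (full_pairs X)) / real (card (PB X X \<times> PB X X))) \<longlongrightarrow> 1)
     card_to_infinity"
proof (rule tendsto_sandwich)
  let ?g = "\<lambda>n :: nat. 1 - 4 * real n ^ 2 * (7 / 8) ^ n :: real"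
  have pos: "0 < card (PB X X \<times> PB X X)" if "finite X" for X :: "'a set"
    using that by (simp add: PB_def card_cartesian_product card_Pow)
  show "\<forall>\<^sub>F X :: 'a set in card_to_infinity.
      ?g (card X) \<le> real (card (full_pairs X)) / real (card (PB X X \<times> PB X X))"
    unfolding eventually_card_to_infinity
    using card_full_pairs_ge pos by (auto simp: pos_le_divide_eq simp del: card_cartesian_product)
  show "\<forall>\<^sub>F X :: 'a set in card_to_infinity.
      real (card (full_pairs X)) / real (card (PB X X \<times> PB X X)) \<le> 1"
    unfolding eventually_card_to_infinity
  proof (intro exI[of _ 0] allI impI)
    fix X :: "'a set" assume X: "finite X \<and> 0 \<le> card X"
    then have "card (full_pairs X) \<le> card (PB X X \<times> PB X X)"
      by (intro card_mono) (auto simp: full_pairs_def PB_def)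
    then show "real (card (full_pairs X)) / real (card (PB X X \<times> PB X X)) \<le> 1"
      using pos X by (simp add: pos_divide_le_eq)
  qed
  have "?g \<longlonglongrightarrow> 1"
    by real_asymp
  moreover have "filterlim card at_top (card_to_infinity :: 'a set filter)"
    unfolding filterlim_at_top eventually_card_to_infinity by blast
  ultimately show "((\<lambda>X :: 'a set. ?g (card X)) \<longlongrightarrow> 1) card_to_infinity"
    by (rule filterlim_compose)
qed simp

end
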